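(* Let $b>0$ be a known real number, and let $X$ have the Poisson distribution with mean $b+\theta$, where $\theta\in[0,\infty)$ is unknown. Under squared error loss for estimating $p=p_\theta(n)=b^n/(b+\theta)^n$ upon observing $X=n$, the estimator $$\hat p(n)=\frac{f_b(n)}{F_b(n)},\qquad n=0,1,2,\dots,$$ is admissible.
   Context: Setting: $X=B+S$ where $B$ and $S$ are independent Poisson random variables with means $b$ (known) and $\theta\ge0$ (unknown) respectively, so $X$ is Poisson with mean $b+\theta$. For $\mu>0$, $f_\mu(n)=e^{-\mu}\mu^n/n!$ and $F_\mu(n)=\sum_{k=0}^nf_\mu(k)$ denote the probability mass function and the cumulative distribution function of the Poisson distribution with mean $\mu$; thus $\hat p(n)=P(B=n\mid B\le n)$. The quantity to be estimated given $X=n$ is $p_\theta(n)=P_\theta[S=0\mid X=n]=b^n/(b+\theta)^n$; note it depends on both $\theta$ and $n$. An estimator $\tilde p$ of $p$ is a function $\tilde p:\{0,1,2,\dots\}\to[0,1]$, used as $\tilde p(X)$. Its risk under squared error loss is $$R(\tilde p,\theta)=E_\theta[(\tilde p-p)^2]=\sum_{n=0}^\infty\Big[\tilde p(n)-\frac{b^n}{(b+\theta)^n}\Big]^2f_{b+\theta}(n),\qquad\theta\ge0.$$ An estimator $\tilde p$ is inadmissible if there is an estimator $\tilde p'$ with $R(\tilde p',\theta)\le R(\tilde p,\theta)$ for all $\theta\ge0$, with strict inequality for some $\theta\ge0$; otherwise it is admissible. *)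

theory Defs
  imports "HOL-Probability.Probability"
begin

text \<open>
  All Poisson means below are used with \<open>b > 0\<close> and \<open>\<theta> \<ge> 0\<close>, so that the mean \<open>b + \<theta>\<close> of \<open>X\<close>
  is positive, as the library's \<open>poisson_pmf\<close> requires.
\<close>

definition poisson_mass :: "real \<Rightarrow> nat \<Rightarrow> real"
  where "poisson_mass \<mu> n = pmf (poisson_pmf \<mu>) n"

definition poisson_cdf :: "real \<Rightarrow> nat \<Rightarrow> real"
  where "poisson_cdf \<mu> n = (\<Sum>k\<le>n. poisson_mass \<mu> k)"

definition p_true :: "real \<Rightarrow> real \<Rightarrow> nat \<Rightarrow> real"
  where "p_true b \<theta> n = b ^ n / (b + \<theta>) ^ n"

definition p_hat :: "real \<Rightarrow> nat \<Rightarrow> real"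
  where "p_hat b n = poisson_mass b n / poisson_cdf b n"

definition estimator :: "(nat \<Rightarrow> real) \<Rightarrow> bool"
  where "estimator d \<longleftrightarrow> (\<forall>n. d n \<in> {0..1})"

definition risk :: "real \<Rightarrow> (nat \<Rightarrow> real) \<Rightarrow> real \<Rightarrow> real"
  where "risk b d \<theta> =
    measure_pmf.expectation (poisson_pmf (b + \<theta>)) (\<lambda>n. (d n - p_true b \<theta> n)\<^sup>2)"

definition inadmissible :: "real \<Rightarrow> (nat \<Rightarrow> real) \<Rightarrow> bool"
  where "inadmissible b d \<longleftrightarrow>
    (\<exists>d'. estimator d' \<and> (\<forall>\<theta>\<ge>0. risk b d' \<theta> \<le> risk b d \<theta>) \<and> (\<exists>\<theta>\<ge>0. risk b d' \<theta> < risk b d \<theta>))"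

definition admissible :: "real \<Rightarrow> (nat \<Rightarrow> real) \<Rightarrow> bool"
  where "admissible b d \<longleftrightarrow> estimator d \<and> \<not> inadmissible b d"

lemma poisson_mass_eq:
  assumes "\<mu> > 0"
  shows "poisson_mass \<mu> n = exp (-\<mu>) * \<mu> ^ n / fact n"
  using assms by (simp add: poisson_mass_def)

text \<open>The target \<open>p_true\<close> is \<open>P(S = 0 | B + S = n)\<close> for independent \<open>B\<close> and \<open>S\<close>
  (at \<open>\<theta> = 0\<close> the signal \<open>S\<close> is identically 0 and both sides are 1).\<close>

lemma p_true_eq_cond_prob:
  assumes b: "b > 0" and t: "\<theta> > 0"
  defines "M \<equiv> measure_pmf (pair_pmf (poisson_pmf b) (poisson_pmf \<theta>))"
  shows "p_true b \<theta> n = cond_prob M (\<lambda>(B, S). S = 0) (\<lambda>(B, S). B + S = n)"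
proof -
  have inj: "inj_on (\<lambda>k. (k, n - k)) {..n}"
    by (auto simp: inj_on_def)
  have eq: "{x :: nat \<times> nat. case x of (B, S) \<Rightarrow> B + S = n} = (\<lambda>k. (k, n - k)) ` {..n}"
    by (auto simp: image_iff)
  have "measure M {x. case x of (B, S) \<Rightarrow> B + S = n} =
      (\<Sum>k\<le>n. pmf (poisson_pmf b) k * pmf (poisson_pmf \<theta>) (n - k))"
    unfolding eq M_def
    by (subst measure_measure_pmf_finite) (simp_all add: sum.reindex[OF inj] pmf_pair o_def)
  also have "\<dots> = (\<Sum>k\<le>n. of_nat (n choose k) * b ^ k * \<theta> ^ (n - k)) * (exp (-b) * exp (-\<theta>) / fact n)"
    unfolding sum_distrib_right using b t
    by (intro sum.cong refl) (simp add: binomial_fact field_simps)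
  also have "\<dots> = (b + \<theta>) ^ n * (exp (-b) * exp (-\<theta>) / fact n)"
    by (simp add: binomial_ring)
  finally have den: "measure M {x. case x of (B, S) \<Rightarrow> B + S = n} =
      (b + \<theta>) ^ n * (exp (-b) * exp (-\<theta>) / fact n)" .
  have "{x :: nat \<times> nat. (case x of (B, S) \<Rightarrow> S = 0) \<and> (case x of (B, S) \<Rightarrow> B + S = n)} = {(n, 0)}"
    by auto
  hence num: "measure M {x. (case x of (B, S) \<Rightarrow> S = 0) \<and> (case x of (B, S) \<Rightarrow> B + S = n)} =
      b ^ n * (exp (-b) * exp (-\<theta>) / fact n)"
    using b t by (simp add: M_def measure_pmf_single pmf_pair)
  have "space M = UNIV"
    by (simp add: M_def)
  thus ?thesis
    unfolding cond_prob_def p_true_def using num den by simp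
qed

lemma p_hat_eq_cond_prob:
  "p_hat b n = cond_prob (measure_pmf (poisson_pmf b)) (\<lambda>B. B = n) (\<lambda>B. B \<le> n)"
proof -
  have "{B. B = n \<and> B \<le> n} = {n}" and "{B. B \<le> n} = {..n}"
    by auto
  thus ?thesis
    by (simp add: p_hat_def cond_prob_def poisson_cdf_def poisson_mass_def
        measure_pmf_single measure_measure_pmf_finite)
qed

text \<open>The expectation defining \<open>risk\<close> exists, so \<open>risk\<close> never takes the default value 0
  of a non-integrable function.\<close>

lemma risk_sums:
  assumes b: "b > 0" and t: "\<theta> \<ge> 0" and d: "estimator d"
  shows "(\<lambda>n. (d n - b ^ n / (b + \<theta>) ^ n)\<^sup>2 * poisson_mass (b + \<theta>) n) sums risk b d \<theta>"
proof -
  let ?g = "\<lambda>n. (d n - p_true b \<theta> n)\<^sup>2"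
  have bnd: "\<bar>?g n\<bar> \<le> 1" for n
  proof -
    have "0 \<le> p_true b \<theta> n" "p_true b \<theta> n \<le> 1"
      using b t by (auto simp: p_true_def divide_le_eq_1 power_mono)
    moreover have "0 \<le> d n" "d n \<le> 1"
      using d by (auto simp: estimator_def)
    ultimately have "\<bar>d n - p_true b \<theta> n\<bar> \<le> 1"
      by linarith
    thus ?thesis
      by (simp add: abs_square_le_1)
  qed
  have int: "integrable (measure_pmf (poisson_pmf (b + \<theta>))) ?g"
    by (rule measure_pmf.integrable_const_bound[where B = 1]) (use bnd in auto)
  have "integrable (count_space UNIV) (\<lambda>n. pmf (poisson_pmf (b + \<theta>)) n *\<^sub>R ?g n)"
    using int by (simp add: measure_pmf_eq_density integrable_density)
  from sums_integral_count_space_nat[OF this]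
  have "(\<lambda>n. pmf (poisson_pmf (b + \<theta>)) n *\<^sub>R ?g n) sums risk b d \<theta>"
    by (simp add: risk_def measure_pmf_eq_density integral_density)
  thus ?thesis
    by (simp add: poisson_mass_def p_true_def mult.commute)
qed

end

theory Submission
  imports Defs
begin

text \<open>
  The estimator \<open>p_hat\<close> is the generalized Bayes estimator for the flat prior \<open>d\<theta>\<close> on \<open>[0, \<infinity>)\<close>.
  Indeed the marginal weight of the observation \<open>n\<close> is
  \<open>\<integral> f\<^bsub>b + \<theta>\<^esub>(n) d\<theta> = F\<^sub>b(n)\<close> (\<open>integral_poisson_mass\<close>), while
  \<open>p\<^sub>\<theta>(n) f\<^bsub>b + \<theta>\<^esub>(n) = f\<^sub>b(n) exp(-\<theta>)\<close> has integral \<open>f\<^sub>b(n)\<close>, so that the posterior mean of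
  \<open>p\<^sub>\<theta>(n)\<close> is \<open>f\<^sub>b(n) / F\<^sub>b(n)\<close>.  Consequently the integrated risk of an estimator \<open>d\<close> splits,
  observation by observation, as
  \<open>\<integral> (d(n) - p\<^sub>\<theta>(n))\<^sup>2 f\<^bsub>b + \<theta>\<^esub>(n) d\<theta> = V\<^sub>n + (d(n) - p_hat(n))\<^sup>2 F\<^sub>b(n)\<close>,
  where \<open>V\<^sub>n\<close> does not depend on \<open>d\<close> (\<open>integral_sq_loss\<close>).

  Although the prior is improper, the integrated risk of \<open>p_hat\<close> is finite: \<open>V\<^sub>n\<close> is at most the
  value for \<open>d(n) = 0\<close>, which is at most \<open>f\<^sub>b(n)\<close> because \<open>p\<^sub>\<theta>(n)\<^sup>2 \<le> p\<^sub>\<theta>(n)\<close>, and these sum to 1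
  (\<open>flat_sq_loss_p_hat_le\<close>).
  If the risk of \<open>d\<close> is nowhere larger than that of \<open>p_hat\<close>, then integrating over \<open>\<theta>\<close> gives
  \<open>\<Sum>n. (d(n) - p_hat(n))\<^sup>2 F\<^sub>b(n) \<le> 0\<close>.  Since every \<open>F\<^sub>b(n)\<close> is positive, \<open>d = p_hat\<close>
  (\<open>eq_p_hat_if_risk_le\<close>), so no estimator is strictly better anywhere.
\<close>

section \<open>Elementary bounds\<close>

lemma poisson_mass_pos: "\<mu> > 0 \<Longrightarrow> poisson_mass \<mu> n > 0"
  by (simp add: poisson_mass_eq)

lemma poisson_mass_le_cdf: "poisson_mass \<mu> n \<le> poisson_cdf \<mu> n"
  unfolding poisson_cdf_def
  by (rule member_le_sum) (auto simp: poisson_mass_def)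

lemma poisson_cdf_pos: "\<mu> > 0 \<Longrightarrow> poisson_cdf \<mu> n > 0"
  using poisson_mass_pos[of \<mu> n] poisson_mass_le_cdf[of \<mu> n] by linarith

lemma poisson_mass_sums_1: "poisson_mass \<mu> sums 1"
proof -
  have "integrable (count_space UNIV) (pmf (poisson_pmf \<mu>))"
    by (rule integrable_pmf)
  from sums_integral_count_space_nat[OF this] show ?thesis
    by (simp add: poisson_mass_def[abs_def] integral_pmf)
qed

lemma estimator_p_hat:
  assumes "b > 0"
  shows "estimator (p_hat b)"
  using poisson_mass_pos[OF assms] poisson_cdf_pos[OF assms] poisson_mass_le_cdf[of b]
  by (auto simp: estimator_def p_hat_def less_imp_le)

lemma p_true_bounds:
  assumes "b > 0" "\<theta> \<ge> 0"
  shows "0 \<le> p_true b \<theta> n" "p_true b \<theta> n \<le> 1"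
  using assms by (auto simp: p_true_def divide_le_eq_1 power_mono)

lemma p_true_times_mass:
  assumes "b > 0" "\<theta> \<ge> 0"
  shows "p_true b \<theta> n * poisson_mass (b + \<theta>) n = poisson_mass b n * exp (- \<theta>)"
proof -
  have "exp (- (b + \<theta>)) = exp (- b) * exp (- \<theta>)"
    by (simp flip: exp_add)
  thus ?thesis
    using assms by (simp add: p_true_def poisson_mass_eq)
qed

section \<open>The flat prior on the parameter\<close>

text \<open>
  The derivative of the distribution function with respect to the mean telescopes.  The masses are
  written out, so that the formula holds for every real \<open>\<mu>\<close>.
\<close>

lemma DERIV_poisson_cdf:
  fixes \<mu> :: real
  shows "((\<lambda>\<mu>. \<Sum>k\<le>n. exp (- \<mu>) * \<mu> ^ k / fact k)
      has_field_derivative - (exp (- \<mu>) * \<mu> ^ n / fact n)) (at \<mu>)"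
proof (induction n)
  case 0
  show ?case by (auto intro!: derivative_eq_intros)
next
  case (Suc n)
  have "((\<lambda>\<mu>. exp (- \<mu>) * \<mu> ^ Suc n / fact (Suc n)) has_field_derivative
      exp (- \<mu>) * \<mu> ^ n / fact n - exp (- \<mu>) * \<mu> ^ Suc n / fact (Suc n)) (at \<mu>)"
  proof -
    have "((\<lambda>\<mu>. exp (- \<mu>) * \<mu> ^ Suc n / fact (Suc n)) has_field_derivative
        (- exp (- \<mu>) * \<mu> ^ Suc n + real (Suc n) * \<mu> ^ n * exp (- \<mu>)) / fact (Suc n)) (at \<mu>)"
      by (auto intro!: derivative_eq_intros simp del: power_Suc fact_Suc)
    moreover have "real (Suc n) / fact (Suc n) = 1 / fact n"
      by (simp add: field_simps del: of_nat_Suc)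
    hence "real (Suc n) * \<mu> ^ n * exp (- \<mu>) / fact (Suc n) = exp (- \<mu>) * \<mu> ^ n / fact n"
      by (metis (no_types, lifting) mult.commute mult.left_commute mult_1 times_divide_eq_left)
    ultimately show ?thesis
      by (simp only: add_divide_distrib diff_conv_add_uminus) (simp add: add.commute)
  qed
  from DERIV_add[OF Suc this] show ?case
    by simp
qed

text \<open>
  Integrals over the parameter space are Lebesgue integrals over the line with an indicator of
  \<open>[0, \<infinity>)\<close>, because \<open>poisson_mass\<close> is specified only for a positive mean.
\<close>

lemma integral_poisson_mass:
  assumes b: "b > 0"
  shows "has_bochner_integral lborel (\<lambda>\<theta>. indicator {0..} \<theta> * poisson_mass (b + \<theta>) n)
    (poisson_cdf b n)"
proof -
  let ?w = "\<lambda>\<theta>. exp (- (b + \<theta>)) * (b + \<theta>) ^ n / fact n"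
  let ?F = "\<lambda>\<mu>. \<Sum>k\<le>n. exp (- \<mu>) * \<mu> ^ k / fact k :: real"
  have eq: "indicator {0..} \<theta> * poisson_mass (b + \<theta>) n = indicator {0..} \<theta> * ?w \<theta>" for \<theta> :: real
    using b by (auto simp: poisson_mass_eq split: split_indicator)
  have lim0: "(?F \<longlongrightarrow> (\<Sum>k\<le>n. 0)) at_top"
  proof (intro tendsto_sum)
    fix k
    have "((\<lambda>\<mu>::real. \<mu> ^ k / exp \<mu> / fact k) \<longlongrightarrow> 0 / fact k) at_top"
      by (intro tendsto_divide tendsto_power_div_exp_0 tendsto_const) auto
    thus "((\<lambda>\<mu>::real. exp (- \<mu>) * \<mu> ^ k / fact k) \<longlongrightarrow> 0) at_top"
      by (simp add: exp_minus field_simps)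
  qed
  have lim: "((\<lambda>\<theta>. - ?F (b + \<theta>)) \<longlongrightarrow> 0) at_top"
    using tendsto_minus[OF filterlim_compose[OF lim0
      filterlim_tendsto_add_at_top[OF tendsto_const filterlim_ident]], of b]
    by simp
  have der: "((\<lambda>\<theta>. - ?F (b + \<theta>)) has_field_derivative ?w \<theta>) (at \<theta>)" for \<theta>
  proof -
    have "((\<lambda>\<theta>. ?F (b + \<theta>)) has_field_derivative - ?w \<theta> * 1) (at \<theta>)"
      by (rule DERIV_chain2[where f = ?F, OF DERIV_poisson_cdf]) (auto intro!: derivative_eq_intros)
    from DERIV_minus[OF this] show ?thesis
      by simp
  qed
  have "(\<integral>\<^sup>+\<theta>. ennreal (?w \<theta>) * indicator {0..} \<theta> \<partial>lborel) = 0 - (- ?F (b + 0))"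
    by (rule nn_integral_FTC_atLeast[OF _ der _ lim]) (use b in auto)
  also have "0 - (- ?F (b + 0)) = poisson_cdf b n"
    using b by (simp add: poisson_cdf_def poisson_mass_eq)
  finally have "(\<integral>\<^sup>+\<theta>. ennreal (?w \<theta>) * indicator {0..} \<theta> \<partial>lborel) = poisson_cdf b n" .
  moreover have "(\<integral>\<^sup>+\<theta>. ennreal (?w \<theta>) * indicator {0..} \<theta> \<partial>lborel) =
      (\<integral>\<^sup>+\<theta>. ennreal (indicator {0..} \<theta> * ?w \<theta>) \<partial>lborel)"
    by (intro nn_integral_cong) (auto split: split_indicator)
  ultimately show ?thesis
    unfolding eq using b poisson_cdf_pos[OF b, of n]
    by (intro has_bochner_integral_nn_integral) (auto split: split_indicator)
qed

lemma integral_p_true_times_mass: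
  assumes b: "b > 0"
  shows "has_bochner_integral lborel
    (\<lambda>\<theta>. indicator {0..} \<theta> * (p_true b \<theta> n * poisson_mass (b + \<theta>) n)) (poisson_mass b n)"
proof -
  \<comment> \<open>The integral of \<open>exp (- \<theta>)\<close> is the case \<open>n = 0\<close> of the preceding lemma, rescaled.\<close>
  have "has_bochner_integral lborel (\<lambda>\<theta>. exp b * (indicator {0..} \<theta> * poisson_mass (b + \<theta>) 0))
      (exp b * poisson_cdf b 0)"
    by (intro has_bochner_integral_mult_right integral_poisson_mass b)
  hence "has_bochner_integral lborel (\<lambda>\<theta>. indicator {0..} \<theta> * exp (- \<theta>) :: real) 1"
    by (rule has_bochner_integral_cong[THEN iffD1, rotated -1])
       (use b in \<open>auto simp: poisson_cdf_def poisson_mass_eq split: split_indicator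
          simp flip: exp_add\<close>)
  hence "has_bochner_integral lborel (\<lambda>\<theta>. poisson_mass b n * (indicator {0..} \<theta> * exp (- \<theta>)))
      (poisson_mass b n * 1)"
    by (intro has_bochner_integral_mult_right)
  thus ?thesis
    by (rule has_bochner_integral_cong[THEN iffD1, rotated -1])
       (use b in \<open>auto simp: p_true_times_mass split: split_indicator\<close>)
qed

section \<open>The integrated loss at one observation\<close>

text \<open>
  The contribution of the observation \<open>n\<close> to the integrated risk of an estimator with value \<open>a\<close>
  at \<open>n\<close>.  For \<open>b > 0\<close> the integral exists, by \<open>integral_sq_loss\<close> below.
\<close>

definition flat_sq_loss :: "real \<Rightarrow> nat \<Rightarrow> real \<Rightarrow> real"
  where "flat_sq_loss b n a =
    (LINT \<theta>|lborel. indicator {0..} \<theta> * ((a - p_true b \<theta> n)\<^sup>2 * poisson_mass (b + \<theta>) n))"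

lemma integrable_sq_loss_0:
  assumes b: "b > 0"
  shows "integrable lborel
    (\<lambda>\<theta>. indicator {0..} \<theta> * ((p_true b \<theta> n)\<^sup>2 * poisson_mass (b + \<theta>) n))"
proof (rule Bochner_Integration.integrable_bound)
  show "integrable lborel (\<lambda>\<theta>. indicator {0..} \<theta> * (p_true b \<theta> n * poisson_mass (b + \<theta>) n))"
    using integral_p_true_times_mass[OF b] by (rule has_bochner_integral_iff[THEN iffD1, THEN conjunct1])
  have "(\<lambda>\<theta>. indicator {0..} \<theta> * ((p_true b \<theta> n)\<^sup>2 * poisson_mass (b + \<theta>) n)) =
      (\<lambda>\<theta>. indicator {0..} \<theta> * (p_true b \<theta> n * (poisson_mass b n * exp (- \<theta>))))"
    using b by (auto simp: p_true_times_mass power2_eq_square mult.assoc split: split_indicator)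
  also have "\<dots> \<in> borel_measurable lborel"
    unfolding p_true_def by measurable
  finally show "(\<lambda>\<theta>. indicator {0..} \<theta> * ((p_true b \<theta> n)\<^sup>2 * poisson_mass (b + \<theta>) n))
      \<in> borel_measurable lborel" .
  show "AE \<theta> in lborel. norm (indicator {0..} \<theta> * ((p_true b \<theta> n)\<^sup>2 * poisson_mass (b + \<theta>) n))
      \<le> norm (indicator {0..} \<theta> * (p_true b \<theta> n * poisson_mass (b + \<theta>) n))"
    using p_true_bounds[OF b]
    by (intro AE_I2)
       (auto simp: abs_mult power2_eq_square poisson_mass_def mult_right_mono mult_left_le
         split: split_indicator)
qed

text \<open>
  Completing the square in \<open>a\<close>: the cross term vanishes because
  \<open>p_hat b n * poisson_cdf b n = poisson_mass b n\<close>.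
\<close>

lemma integral_sq_loss:
  assumes b: "b > 0"
  shows "has_bochner_integral lborel
    (\<lambda>\<theta>. indicator {0..} \<theta> * ((a - p_true b \<theta> n)\<^sup>2 * poisson_mass (b + \<theta>) n))
    (flat_sq_loss b n (p_hat b n) + (a - p_hat b n)\<^sup>2 * poisson_cdf b n)"
proof -
  have expand: "has_bochner_integral lborel
      (\<lambda>\<theta>. indicator {0..} \<theta> * ((a - p_true b \<theta> n)\<^sup>2 * poisson_mass (b + \<theta>) n))
      (flat_sq_loss b n 0 + a\<^sup>2 * poisson_cdf b n - 2 * a * poisson_mass b n)" for a
  proof -
    have "has_bochner_integral lborel
      (\<lambda>\<theta>. indicator {0..} \<theta> * ((p_true b \<theta> n)\<^sup>2 * poisson_mass (b + \<theta>) n)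
         + a\<^sup>2 * (indicator {0..} \<theta> * poisson_mass (b + \<theta>) n)
         - 2 * a * (indicator {0..} \<theta> * (p_true b \<theta> n * poisson_mass (b + \<theta>) n)))
      (flat_sq_loss b n 0 + a\<^sup>2 * poisson_cdf b n - 2 * a * poisson_mass b n)"
      using integrable_sq_loss_0[OF b, of n]
      by (intro has_bochner_integral_diff has_bochner_integral_add has_bochner_integral_mult_right
          integral_poisson_mass integral_p_true_times_mass b)
         (simp add: has_bochner_integral_iff flat_sq_loss_def)
    thus ?thesis
      by (rule has_bochner_integral_cong[THEN iffD1, rotated -1])
         (auto simp: power2_eq_square algebra_simps)
  qed
  have "flat_sq_loss b n (p_hat b n) =
      flat_sq_loss b n 0 + (p_hat b n)\<^sup>2 * poisson_cdf b n - 2 * p_hat b n * poisson_mass b n"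
    unfolding flat_sq_loss_def[of b n "p_hat b n"]
    using expand by (rule has_bochner_integral_integral_eq)
  moreover have "poisson_mass b n = p_hat b n * poisson_cdf b n"
    using poisson_cdf_pos[OF b, of n] by (simp add: p_hat_def)
  ultimately have eq: "flat_sq_loss b n 0 + a\<^sup>2 * poisson_cdf b n - 2 * a * poisson_mass b n =
      flat_sq_loss b n (p_hat b n) + (a - p_hat b n)\<^sup>2 * poisson_cdf b n"
    by (simp add: power2_eq_square algebra_simps)
  show ?thesis
    using expand[of a] unfolding eq .
qed

lemma flat_sq_loss_nonneg: "flat_sq_loss b n a \<ge> 0"
  unfolding flat_sq_loss_def
  by (intro integral_nonneg_AE AE_I2) (auto simp: poisson_mass_def split: split_indicator)

text \<open>
  The constant guess 0 already achieves this bound, and \<open>p_hat b n\<close> is the best guess.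
\<close>

lemma flat_sq_loss_p_hat_le:
  assumes b: "b > 0"
  shows "flat_sq_loss b n (p_hat b n) \<le> poisson_mass b n"
proof -
  have "flat_sq_loss b n (p_hat b n) \<le>
      flat_sq_loss b n (p_hat b n) + (0 - p_hat b n)\<^sup>2 * poisson_cdf b n"
    using poisson_cdf_pos[OF b, of n] by simp
  also have "\<dots> = (LINT \<theta>|lborel.
      indicator {0..} \<theta> * ((0 - p_true b \<theta> n)\<^sup>2 * poisson_mass (b + \<theta>) n))"
    by (rule has_bochner_integral_integral_eq[OF integral_sq_loss[OF b], symmetric])
  also have "\<dots> \<le> (LINT \<theta>|lborel.
      indicator {0..} \<theta> * (p_true b \<theta> n * poisson_mass (b + \<theta>) n))"
  proof (rule integral_mono)
    fix \<theta> :: real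
    show "indicator {0..} \<theta> * ((0 - p_true b \<theta> n)\<^sup>2 * poisson_mass (b + \<theta>) n)
        \<le> indicator {0..} \<theta> * (p_true b \<theta> n * poisson_mass (b + \<theta>) n)"
      using p_true_bounds[OF b, of \<theta> n]
      by (auto simp: power2_eq_square poisson_mass_def mult_right_mono mult_left_le
          split: split_indicator)
  qed (use integral_sq_loss[OF b, of 0 n] integral_p_true_times_mass[OF b, of n]
       in \<open>auto simp: has_bochner_integral_iff\<close>)
  also have "\<dots> = poisson_mass b n"
    by (rule has_bochner_integral_integral_eq[OF integral_p_true_times_mass[OF b]])
  finally show ?thesis .
qed

section \<open>Uniqueness of the generalized Bayes estimator\<close>

text \<open>By Tonelli's theorem, the integrated risk is the sum of the integrated losses.\<close>

lemma nn_integral_risk: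
  assumes b: "b > 0" and d: "estimator d"
  shows "(\<integral>\<^sup>+\<theta>. ennreal (indicator {0..} \<theta> * risk b d \<theta>) \<partial>lborel) =
    (\<Sum>n. ennreal (flat_sq_loss b n (p_hat b n)) + ennreal ((d n - p_hat b n)\<^sup>2 * poisson_cdf b n))"
proof -
  let ?g = "\<lambda>n \<theta>. indicator {0..} \<theta> * ((d n - p_true b \<theta> n)\<^sup>2 * poisson_mass (b + \<theta>) n)"
  have g0: "?g n \<theta> \<ge> 0" for n \<theta>
    by (auto simp: poisson_mass_def split: split_indicator)
  have "ennreal (indicator {0..} \<theta> * risk b d \<theta>) = (\<Sum>n. ennreal (?g n \<theta>))" for \<theta> :: real
  proof (cases "\<theta> \<ge> 0")
    case True
    from risk_sums[OF b True d] have "(\<lambda>n. ?g n \<theta>) sums (indicator {0..} \<theta> * risk b d \<theta>)"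
      by (intro sums_mult) (simp add: p_true_def)
    thus ?thesis
      using suminf_ennreal_eq[OF g0] by simp
  qed auto
  hence "(\<integral>\<^sup>+\<theta>. ennreal (indicator {0..} \<theta> * risk b d \<theta>) \<partial>lborel) =
      (\<integral>\<^sup>+\<theta>. (\<Sum>n. ennreal (?g n \<theta>)) \<partial>lborel)"
    by simp
  also have "\<dots> = (\<Sum>n. \<integral>\<^sup>+\<theta>. ennreal (?g n \<theta>) \<partial>lborel)"
  proof (rule nn_integral_suminf)
    fix n
    have "?g n \<in> borel_measurable lborel"
      using integral_sq_loss[OF b, of "d n" n]
      by (auto simp: has_bochner_integral_iff intro: borel_measurable_integrable)
    thus "(\<lambda>\<theta>. ennreal (?g n \<theta>)) \<in> borel_measurable lborel"
      by measurable
  qed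
  also have "\<dots> = (\<Sum>n. ennreal (flat_sq_loss b n (p_hat b n))
      + ennreal ((d n - p_hat b n)\<^sup>2 * poisson_cdf b n))"
  proof (intro suminf_cong)
    fix n
    have "(\<integral>\<^sup>+\<theta>. ennreal (?g n \<theta>) \<partial>lborel) = ennreal (LINT \<theta>|lborel. ?g n \<theta>)"
      using integral_sq_loss[OF b, of "d n" n] g0
      by (intro nn_integral_eq_integral) (auto simp: has_bochner_integral_iff)
    also have "(LINT \<theta>|lborel. ?g n \<theta>) =
        flat_sq_loss b n (p_hat b n) + (d n - p_hat b n)\<^sup>2 * poisson_cdf b n"
      using integral_sq_loss[OF b] by (rule has_bochner_integral_integral_eq)
    finally show "(\<integral>\<^sup>+\<theta>. ennreal (?g n \<theta>) \<partial>lborel) = ennreal (flat_sq_loss b n (p_hat b n))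
        + ennreal ((d n - p_hat b n)\<^sup>2 * poisson_cdf b n)"
      using flat_sq_loss_nonneg[of b n "p_hat b n"] poisson_cdf_pos[OF b, of n]
      by (simp add: ennreal_plus)
  qed
  finally show ?thesis .
qed

lemma eq_p_hat_if_risk_le:
  assumes b: "b > 0" and d: "estimator d"
    and le: "\<And>\<theta>. \<theta> \<ge> 0 \<Longrightarrow> risk b d \<theta> \<le> risk b (p_hat b) \<theta>"
  shows "d = p_hat b"
proof -
  let ?V = "\<Sum>n. ennreal (flat_sq_loss b n (p_hat b n))"
  let ?e = "\<lambda>n. ennreal ((d n - p_hat b n)\<^sup>2 * poisson_cdf b n)"
  have "?V \<le> (\<Sum>n. ennreal (poisson_mass b n))"
    by (intro suminf_le ennreal_leI flat_sq_loss_p_hat_le b summableI)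
  also have "\<dots> = ennreal 1"
    by (intro suminf_ennreal_eq poisson_mass_sums_1) (simp add: poisson_mass_def)
  finally have fin: "?V \<noteq> top"
    by (auto simp: top_unique)
  have "?V + (\<Sum>n. ?e n) = (\<integral>\<^sup>+\<theta>. ennreal (indicator {0..} \<theta> * risk b d \<theta>) \<partial>lborel)"
    by (simp add: nn_integral_risk[OF b d] suminf_add[OF summableI summableI])
  also have "\<dots> \<le> (\<integral>\<^sup>+\<theta>. ennreal (indicator {0..} \<theta> * risk b (p_hat b) \<theta>) \<partial>lborel)"
    by (intro nn_integral_mono ennreal_leI) (auto simp: le split: split_indicator)
  also have "\<dots> = ?V + 0"
    by (simp add: nn_integral_risk[OF b estimator_p_hat[OF b]])
  \<comment> \<open>Cancelling \<open>?V\<close> needs it to be finite; this is where the improper prior could fail.\<close>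
  finally have "(\<Sum>n. ?e n) = 0"
    using fin by (simp add: ennreal_add_left_cancel_le del: add_0_right)
  have "d n = p_hat b n" for n
  proof -
    have "sum ?e {n} \<le> (\<Sum>n. ?e n)"
      by (intro sum_le_suminf summableI) auto
    hence "?e n = 0"
      using \<open>(\<Sum>n. ?e n) = 0\<close> by simp
    hence "(d n - p_hat b n)\<^sup>2 * poisson_cdf b n \<le> 0"
      by (simp add: ennreal_eq_0_iff)
    thus ?thesis
      using poisson_cdf_pos[OF b, of n] by (simp add: mult_le_0_iff)
  qed
  thus ?thesis ..
qed

theorem corollary2:
  fixes b :: real
  assumes "b > 0"
  shows "admissible b (p_hat b)"
  using estimator_p_hat[OF assms] eq_p_hat_if_risk_le[OF assms]
  unfolding admissible_def inadmissible_def by fastforce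

end
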